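(* Let $\nu\in(0,1]$, let $\mathcal{Y}^\nu(t)$, $t>0$, be a nonlinear fractional pure birth process with pairwise distinct birth rates $\lambda_j>0$, $j\in\mathbb{N}$, and one progenitor ($\mathcal{Y}^\nu(0)=1$), and let $N_\alpha$ be a homogeneous Poisson process with rate $\lambda_\alpha>0$, independent of $\mathcal{Y}^\nu$. Let $X_1,X_2,\dots$ be i.i.d. Poisson random variables with parameter $\lambda_\alpha$, independent of $\mathcal{Y}^\nu$. Then for every $t>0$, $$N_\alpha(\mathcal{Y}^\nu(t))\overset{d}{=}\sum_{j=1}^{\mathcal{Y}^\nu(t)}X_j .$$
   Context: The nonlinear fractional pure birth process $\mathcal{Y}^\nu(t)$ takes values in $\{1,2,\dots\}$ and has one-dimensional distributions $$\Pr\{\mathcal{Y}^\nu(t)=k\mid\mathcal{Y}^\nu(0)=1\}=\begin{cases}\prod_{j=1}^{k-1}\lambda_j\,\sum_{m=1}^k\dfrac{E_{\nu,1}(-\lambda_mt^\nu)}{\prod_{l=1,l\ne m}^k(\lambda_l-\lambda_m)},&k>1,\\[2mm]E_{\nu,1}(-\lambda_1t^\nu),&k=1,\end{cases}$$ where $E_{\nu,1}(x)=\sum_{r=0}^\infty \frac{x^r}{\Gamma(\nu r+1)}$ is the Mittag--Leffler function; it is assumed that these probabilities sum to $1$ over $k\ge1$. $\overset{d}{=}$ denotes equality in distribution for each fixed $t>0$. *)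

theory Defs
  imports "HOL-Probability.Probability"
begin

definition mittag_leffler :: "real \<Rightarrow> real \<Rightarrow> real \<Rightarrow> real" where
  "mittag_leffler \<nu> \<mu> x = (\<Sum>r. x ^ r / Gamma (\<nu> * real r + \<mu>))"

text \<open>The one-dimensional distributions of the nonlinear fractional pure birth process with
  birth rates \<open>\<beta> 1, \<beta> 2, \<dots>\<close> and one progenitor; the value \<open>\<beta> 0\<close> plays no role.\<close>

definition birth_prob :: "real \<Rightarrow> (nat \<Rightarrow> real) \<Rightarrow> real \<Rightarrow> nat \<Rightarrow> real" where
  "birth_prob \<nu> \<beta> t k =
     (if k = 1 then mittag_leffler \<nu> 1 (- \<beta> 1 * t powr \<nu>)
      else (\<Prod>j=1..k-1. \<beta> j) *
        (\<Sum>m=1..k. mittag_leffler \<nu> 1 (- \<beta> m * t powr \<nu>) / (\<Prod>l\<in>{1..k}-{m}. \<beta> l - \<beta> m)))"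

text \<open>Processes are families \<open>Y :: real \<Rightarrow> 'a \<Rightarrow> nat\<close> of random variables; only times in
  \<open>{0..}\<close> are relevant.\<close>

definition (in prob_space) fractional_pure_birth_process ::
  "real \<Rightarrow> (nat \<Rightarrow> real) \<Rightarrow> (real \<Rightarrow> 'a \<Rightarrow> nat) \<Rightarrow> bool" where
  "fractional_pure_birth_process \<nu> \<beta> Y \<longleftrightarrow>
     (\<forall>t\<ge>0. random_variable (count_space UNIV) (Y t)) \<and>
     (\<forall>t\<ge>0. \<forall>\<omega>\<in>space M. Y t \<omega> \<ge> 1) \<and>
     (AE \<omega> in M. Y 0 \<omega> = 1) \<and>
     (\<forall>t>0. \<forall>k\<ge>1. \<P>(\<omega> in M. Y t \<omega> = k \<bar> Y 0 \<omega> = 1) = birth_prob \<nu> \<beta> t k)"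

text \<open>Since almost all paths are nondecreasing, the truncated subtraction on \<^typ>\<open>nat\<close> is the
  true increment almost surely.\<close>

definition (in prob_space) homogeneous_poisson_process ::
  "real \<Rightarrow> (real \<Rightarrow> 'a \<Rightarrow> nat) \<Rightarrow> bool" where
  "homogeneous_poisson_process r N \<longleftrightarrow>
     (\<forall>t\<ge>0. random_variable (count_space UNIV) (N t)) \<and>
     (AE \<omega> in M. N 0 \<omega> = 0) \<and>
     (AE \<omega> in M. mono_on {0..} (\<lambda>t. N t \<omega>) \<and>
                 (\<forall>t\<ge>0. continuous (at_right t) (\<lambda>t. N t \<omega>))) \<and>
     (\<forall>n \<tau>. 0 \<le> \<tau> 0 \<and> mono_on {..n} \<tau> \<longrightarrow>
        indep_vars (\<lambda>_. count_space UNIV) (\<lambda>i \<omega>. N (\<tau> (Suc i)) \<omega> - N (\<tau> i) \<omega>) {..<n}) \<and>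
     (\<forall>s t. 0 \<le> s \<and> s < t \<longrightarrow>
        distr M (count_space UNIV) (\<lambda>\<omega>. N t \<omega> - N s \<omega>) = measure_pmf (poisson_pmf (r * (t - s))))"

definition (in prob_space) iid_poisson :: "real \<Rightarrow> (nat \<Rightarrow> 'a \<Rightarrow> nat) \<Rightarrow> bool" where
  "iid_poisson r X \<longleftrightarrow>
     indep_vars (\<lambda>_. count_space UNIV) X {1..} \<and>
     (\<forall>j\<ge>1. distr M (count_space UNIV) (X j) = measure_pmf (poisson_pmf r))"

text \<open>Independence of the generated \<open>\<sigma>\<close>-algebras of two families of random variables.\<close>

definition (in prob_space) indep_processes ::
  "'i set \<Rightarrow> ('i \<Rightarrow> 'a \<Rightarrow> nat) \<Rightarrow> 'j set \<Rightarrow> ('j \<Rightarrow> 'a \<Rightarrow> nat) \<Rightarrow> bool" where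
  "indep_processes I X J Y \<longleftrightarrow>
     indep_set (sigma_sets (space M) {X i -` A \<inter> space M | i A. i \<in> I})
               (sigma_sets (space M) {Y j -` A \<inter> space M | j A. j \<in> J})"

text \<open>Measurability is part of the definition because \<^const>\<open>distr\<close> is only meaningful for
  measurable maps.\<close>

definition eq_in_distribution ::
  "'a measure \<Rightarrow> ('a \<Rightarrow> 'c) \<Rightarrow> 'b measure \<Rightarrow> ('b \<Rightarrow> 'c) \<Rightarrow> 'c measure \<Rightarrow> bool" where
  "eq_in_distribution M X M' Y S \<longleftrightarrow>
     X \<in> measurable M S \<and> Y \<in> measurable M' S \<and> distr M S X = distr M' S Y"

end

theory Submission
  imports Defs
begin

text \<open>Both sides are a \<^typ>\<open>nat\<close>-indexed family of random variables evaluated at the random index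
  \<open>Y t\<close>, which is independent of the family; so it suffices to compare the laws at each
  deterministic index \<open>k\<close>. The law of \<open>N k\<close> needs no Poisson convolution: \<open>N k\<close> is almost surely the
  telescoping sum of its \<open>k\<close> unit-time increments, which are i.i.d. Poisson just like
  \<open>X 1, \<dots>, X k\<close>.\<close>

text \<open>Countably many values of \<open>T\<close> partition the space, and on
  \<open>T = k\<close> the composite is just \<open>F k\<close>. Independence then makes its law a
  mixture of the laws of the \<open>F k\<close>, weighted by the law of \<open>T\<close>. Hence
  independence from \<open>T\<close> is asked of each \<open>F k\<close> separately, not of the
  family jointly.\<close>

lemma (in prob_space) distr_random_index_cong:
  fixes T :: "'a \<Rightarrow> 'i::countable" and F G :: "'i \<Rightarrow> 'a \<Rightarrow> 'b"
  assumes T [measurable]: "random_variable (count_space UNIV) T"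
    and F [measurable]: "\<And>k. random_variable S (F k)"
    and G [measurable]: "\<And>k. random_variable S (G k)"
    and indF: "\<And>k. indep_set {F k -` A \<inter> space M |A. A \<in> sets S} {T -` B \<inter> space M |B. True}"
    and indG: "\<And>k. indep_set {G k -` A \<inter> space M |A. A \<in> sets S} {T -` B \<inter> space M |B. True}"
    and eq: "\<And>k. distr M S (F k) = distr M S (G k)"
  shows "distr M S (\<lambda>\<omega>. F (T \<omega>) \<omega>) = distr M S (\<lambda>\<omega>. G (T \<omega>) \<omega>)"
proof (rule measure_eqI)
  \<comment> \<open>The mixture formula, for a generic family \<open>H\<close> so that it serves
    both \<open>F\<close> and \<open>G\<close>; its right-hand side sees \<open>H\<close> only
    through the laws of the \<open>H k\<close>.\<close>
  have split: "emeasure (distr M S (\<lambda>\<omega>. H (T \<omega>) \<omega>)) A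
      = (\<integral>\<^sup>+k. emeasure (distr M S (H k)) A * emeasure M (T -` {k} \<inter> space M) \<partial>count_space UNIV)"
    if Hm [measurable]: "\<And>k. random_variable S (H k)"
      and ind: "\<And>k. indep_set {H k -` A \<inter> space M |A. A \<in> sets S} {T -` B \<inter> space M |B. True}"
      and A [measurable]: "A \<in> sets S"
    for H :: "'i \<Rightarrow> 'a \<Rightarrow> 'b" and A
  proof -
    have Int: "prob ((H k -` A \<inter> space M) \<inter> (T -` {k} \<inter> space M))
        = prob (H k -` A \<inter> space M) * prob (T -` {k} \<inter> space M)" for k
      using A by (intro indep_setD[OF ind[of k]]) auto
    have HTm: "random_variable S (\<lambda>\<omega>. H (T \<omega>) \<omega>)"
      by (rule measurable_compose_countable) measurable
    have "emeasure (distr M S (\<lambda>\<omega>. H (T \<omega>) \<omega>)) A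
        = emeasure M (\<Union>k. (H k -` A \<inter> space M) \<inter> (T -` {k} \<inter> space M))"
      using HTm by (auto simp: emeasure_distr intro!: arg_cong[where f = "emeasure M"])
    also have "\<dots> = (\<integral>\<^sup>+k. emeasure M ((H k -` A \<inter> space M) \<inter> (T -` {k} \<inter> space M))
        \<partial>count_space UNIV)"
      by (intro emeasure_UN_countable) (auto simp: disjoint_family_on_def)
    also have "\<dots> = (\<integral>\<^sup>+k. emeasure (distr M S (H k)) A * emeasure M (T -` {k} \<inter> space M)
        \<partial>count_space UNIV)"
      using Int by (simp add: emeasure_distr emeasure_eq_measure ennreal_mult)
    finally show ?thesis .
  qed
  fix A assume "A \<in> sets (distr M S (\<lambda>\<omega>. F (T \<omega>) \<omega>))"
  then show "emeasure (distr M S (\<lambda>\<omega>. F (T \<omega>) \<omega>)) A = emeasure (distr M S (\<lambda>\<omega>. G (T \<omega>) \<omega>)) A"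
    using split[of F A, OF F indF] split[of G A, OF G indG] by (simp add: eq)
qed simp

text \<open>Preimages under a functional \<open>g\<close> of the whole family \<open>X\<close> stay
  in the sigma-algebra generated by that family, so independence of the processes passes to
  \<open>g\<close> and a single \<open>Z j\<close>. This covers one coordinate as well as a partial
  sum.\<close>

lemma (in prob_space) indep_processes_imp_indep_set_vimages:
  assumes ind: "indep_processes I X J Z"
    and "j \<in> J"
    and g: "g \<in> measurable (sigma (space M) {X i -` A \<inter> space M |i A. i \<in> I}) S"
  shows "indep_set {g -` A \<inter> space M |A. A \<in> sets S} {Z j -` B \<inter> space M |B. True}"
proof -
  let ?GX = "{X i -` A \<inter> space M |i A. i \<in> I}" and ?GZ = "{Z j -` A \<inter> space M |j A. j \<in> J}"
  have GX: "?GX \<subseteq> Pow (space M)" by auto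
  have "g -` A \<inter> space M \<in> sigma_sets (space M) ?GX" if "A \<in> sets S" for A
    using measurable_sets[OF g that] GX by (simp add: space_measure_of_conv)
  then have "{g -` A \<inter> space M |A. A \<in> sets S} \<subseteq> sigma_sets (space M) ?GX"
    by auto
  moreover have "{Z j -` B \<inter> space M |B. True} \<subseteq> sigma_sets (space M) ?GZ"
    using \<open>j \<in> J\<close> by (auto intro!: sigma_sets.Basic)
  ultimately show ?thesis
    using ind unfolding indep_processes_def indep_sets2_eq by blast
qed

lemma measurable_sigma_vimages:
  fixes X :: "'i \<Rightarrow> 'a \<Rightarrow> 'b"
  assumes "i \<in> I"
  shows "X i \<in> measurable (sigma \<Omega> {X i -` A \<inter> \<Omega> |i A. i \<in> I}) (count_space UNIV)"
proof -
  have "{X i -` A \<inter> \<Omega> |i A. i \<in> I} \<subseteq> Pow \<Omega>" by auto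
  then show ?thesis
    using assms by (intro measurableI) (auto simp only: sets_measure_of space_measure_of
        space_count_space intro!: sigma_sets.Basic)
qed

text \<open>The source space is left general: the lemma is applied over the probability space, over
  a product space, and over the sigma-algebra generated by a family.\<close>

lemma measurable_sum_nat_count_space:
  fixes f :: "'i \<Rightarrow> 'a \<Rightarrow> nat"
  assumes "\<And>i. i \<in> I \<Longrightarrow> f i \<in> measurable M (count_space UNIV)"
  shows "(\<lambda>x. \<Sum>i\<in>I. f i x) \<in> measurable M (count_space UNIV)"
  using assms
proof (induction I rule: infinite_finite_induct)
  case (insert i I)
  then have [measurable]: "f i \<in> measurable M (count_space UNIV)"
    "(\<lambda>x. \<Sum>i\<in>I. f i x) \<in> measurable M (count_space UNIV)" by auto
  from insert(1,2) show ?case by simp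
qed auto

text \<open>By independence the joint law is the product of the marginals, so equal marginals give
  equal joint laws; the sum is a measurable image of the joint vector.\<close>

lemma (in prob_space) distr_sum_cong_indep_vars:
  fixes U V :: "'i \<Rightarrow> 'a \<Rightarrow> nat"
  assumes U: "indep_vars (\<lambda>_. count_space UNIV) U I"
    and V: "indep_vars (\<lambda>_. count_space UNIV) V I"
    and eq: "\<And>i. i \<in> I \<Longrightarrow> distr M (count_space UNIV) (U i) = distr M (count_space UNIV) (V i)"
  shows "distr M (count_space UNIV) (\<lambda>\<omega>. \<Sum>i\<in>I. U i \<omega>)
    = distr M (count_space UNIV) (\<lambda>\<omega>. \<Sum>i\<in>I. V i \<omega>)"
\<comment> \<open>The product characterisation of independence requires a nonempty index set; for
  empty \<open>I\<close> both sums are 0.\<close>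
proof (cases "I = {}")
  case False
  let ?C = "count_space UNIV :: nat measure"
  let ?P = "\<Pi>\<^sub>M i\<in>I. ?C"
  have joint: "distr M ?P (\<lambda>\<omega>. \<lambda>i\<in>I. W i \<omega>) = (\<Pi>\<^sub>M i\<in>I. distr M ?C (W i))"
    and sum: "distr M ?C (\<lambda>\<omega>. \<Sum>i\<in>I. W i \<omega>) = distr (distr M ?P (\<lambda>\<omega>. \<lambda>i\<in>I. W i \<omega>)) ?C (\<lambda>f. \<Sum>i\<in>I. f i)"
    if W: "indep_vars (\<lambda>_. ?C) W I" for W
  proof -
    have rv: "random_variable ?C (W i)" if "i \<in> I" for i
      using W that unfolding indep_vars_def2 by blast
    show "distr M ?P (\<lambda>\<omega>. \<lambda>i\<in>I. W i \<omega>) = (\<Pi>\<^sub>M i\<in>I. distr M ?C (W i))"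
      using indep_vars_iff_distr_eq_PiM'[OF False rv] W by simp
    have "(\<lambda>f. \<Sum>i\<in>I. f i) \<in> measurable ?P ?C"
      by (rule measurable_sum_nat_count_space) measurable
    moreover have "(\<lambda>\<omega>. \<lambda>i\<in>I. W i \<omega>) \<in> measurable M ?P"
      using rv by measurable
    ultimately show "distr M ?C (\<lambda>\<omega>. \<Sum>i\<in>I. W i \<omega>)
        = distr (distr M ?P (\<lambda>\<omega>. \<lambda>i\<in>I. W i \<omega>)) ?C (\<lambda>f. \<Sum>i\<in>I. f i)"
      by (simp add: distr_distr comp_def)
  qed
  have "(\<Pi>\<^sub>M i\<in>I. distr M ?C (U i)) = (\<Pi>\<^sub>M i\<in>I. distr M ?C (V i))"
    using eq by (intro PiM_cong) auto
  then show ?thesis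
    using sum[OF U] sum[OF V] joint[OF U] joint[OF V] by simp
qed simp

lemma (in prob_space) distr_poisson_process_eq_sum_iid_poisson:
  assumes N: "homogeneous_poisson_process r N" and X: "iid_poisson r X"
  shows "distr M (count_space UNIV) (N (real k))
    = distr M (count_space UNIV) (\<lambda>\<omega>. \<Sum>j=1..k. X j \<omega>)"
proof -
  let ?C = "count_space UNIV :: nat measure"
  have incr_indep: "\<forall>n \<tau>. 0 \<le> \<tau> 0 \<and> mono_on {..n} \<tau> \<longrightarrow>
      indep_vars (\<lambda>_. ?C) (\<lambda>i \<omega>. N (\<tau> (Suc i)) \<omega> - N (\<tau> i) \<omega>) {..<n}"
    and incr_distr: "\<forall>s t. 0 \<le> s \<and> s < t \<longrightarrow>
      distr M ?C (\<lambda>\<omega>. N t \<omega> - N s \<omega>) = measure_pmf (poisson_pmf (r * (t - s)))"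
    using N unfolding homogeneous_poisson_process_def by simp_all
  \<comment> \<open>For \<open>i \<ge> 1\<close> this is the increment over the unit interval from
    \<open>i - 1\<close> to \<open>i\<close>, numbered to match \<open>X i\<close>;
    \<open>D 0\<close> is identically 0, since \<open>0 - 1 = 0\<close> on naturals.\<close>
  define D where "D i \<omega> = N (real i) \<omega> - N (real (i - 1)) \<omega>" for i \<omega>
  have Nm [measurable]: "random_variable ?C (N (real i))" for i
    using N unfolding homogeneous_poisson_process_def by simp
  have Dm: "random_variable ?C (D i)" for i
    unfolding D_def by measurable
  have D: "indep_vars (\<lambda>_. ?C) D {1..k}"
  proof (rule indep_vars_subset)
    \<comment> \<open>The times are 0, 0, 1, ..., \<open>k\<close>: repeating 0 makes the increment
      with index \<open>i\<close> exactly \<open>D i\<close>, and the degenerate \<open>D 0\<close>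
      is dropped by restricting to \<open>{1..k}\<close>.\<close>
    let ?\<tau> = "\<lambda>i. real (i - 1)"
    have "0 \<le> ?\<tau> 0 \<and> mono_on {..Suc k} ?\<tau>" by (auto intro!: mono_onI)
    from incr_indep[rule_format, OF this]
    show "indep_vars (\<lambda>_. ?C) D {..<Suc k}"
      by (simp add: D_def[abs_def])
  qed auto
  have X': "indep_vars (\<lambda>_. ?C) X {1..}"
    and Xd: "\<And>j. j \<ge> 1 \<Longrightarrow> distr M ?C (X j) = measure_pmf (poisson_pmf r)"
    using X unfolding iid_poisson_def by auto
  have X'': "indep_vars (\<lambda>_. ?C) X {1..k}"
    by (rule indep_vars_subset[OF X']) auto
  have "distr M ?C (D j) = measure_pmf (poisson_pmf r)" if "j \<ge> 1" for j
  proof -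
    have "0 \<le> real (j - 1) \<and> real (j - 1) < real j" using that by simp
    from incr_distr[rule_format, OF this] that show ?thesis
      by (simp add: of_nat_diff D_def[abs_def])
  qed
  then have sums: "distr M ?C (\<lambda>\<omega>. \<Sum>j=1..k. D j \<omega>) = distr M ?C (\<lambda>\<omega>. \<Sum>j=1..k. X j \<omega>)"
    by (intro distr_sum_cong_indep_vars D X'') (simp add: Xd)
  have "AE \<omega> in M. N 0 \<omega> = 0" "AE \<omega> in M. mono_on {0..} (\<lambda>t. N t \<omega>)"
    using N unfolding homogeneous_poisson_process_def by auto
  then have "AE \<omega> in M. N (real k) \<omega> = (\<Sum>j=1..k. D j \<omega>)"
  proof eventually_elim
    case (elim \<omega>)
    show ?case
    proof (induction k)
      case (Suc k)
      \<comment> \<open>Monotone paths make the truncated subtraction in \<open>D (Suc k)\<close> a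
        true difference, so adding it back telescopes.\<close>
      have "N (real k) \<omega> \<le> N (real (Suc k)) \<omega>"
        by (rule mono_onD[OF elim(2)]) auto
      with Suc show ?case by (simp add: D_def)
    qed (simp add: elim)
  qed
  then have "distr M ?C (N (real k)) = distr M ?C (\<lambda>\<omega>. \<Sum>j=1..k. D j \<omega>)"
    by (intro distr_cong_AE measurable_sum_nat_count_space Dm Nm) auto
  also note sums
  finally show ?thesis .
qed

theorem theorem2p4:
  fixes M :: "'a measure"
    and \<nu> r :: real
    and \<beta> :: "nat \<Rightarrow> real"
    and Y N :: "real \<Rightarrow> 'a \<Rightarrow> nat"
    and X :: "nat \<Rightarrow> 'a \<Rightarrow> nat"
  assumes "prob_space M"
    and "0 < \<nu>" and "\<nu> \<le> 1"
    and "\<forall>j\<ge>1. \<beta> j > 0" and "inj_on \<beta> {1..}"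
    and "\<forall>t>0. (\<lambda>k. birth_prob \<nu> \<beta> t (Suc k)) sums 1"
    and "prob_space.fractional_pure_birth_process M \<nu> \<beta> Y"
    and "r > 0"
    and "prob_space.homogeneous_poisson_process M r N"
    and "prob_space.indep_processes M {0..} N {0..} Y"
    and "prob_space.iid_poisson M r X"
    and "prob_space.indep_processes M {1..} X {0..} Y"
  shows "\<forall>t>0. eq_in_distribution
           M (\<lambda>\<omega>. N (real (Y t \<omega>)) \<omega>)
           M (\<lambda>\<omega>. \<Sum>j=1..Y t \<omega>. X j \<omega>) (count_space UNIV)"
proof (intro allI impI)
  fix t :: real assume "t > 0"
  interpret prob_space M by fact
  let ?C = "count_space UNIV :: nat measure"
  have Y [measurable]: "random_variable ?C (Y t)"
    using assms(7) \<open>t > 0\<close> unfolding fractional_pure_birth_process_def by auto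
  have Nm [measurable]: "random_variable ?C (N (real k))" for k
    using assms(9) unfolding homogeneous_poisson_process_def by simp
  have Xm [measurable]: "random_variable ?C (\<lambda>\<omega>. \<Sum>j=1..k. X j \<omega>)" for k
    using assms(11) unfolding iid_poisson_def indep_vars_def2
    by (intro measurable_sum_nat_count_space) auto
  have indN: "indep_set {N (real k) -` A \<inter> space M |A. A \<in> sets ?C} {Y t -` B \<inter> space M |B. True}" for k
    using \<open>t > 0\<close>
    by (intro indep_processes_imp_indep_set_vimages[OF assms(10)] measurable_sigma_vimages) auto
  \<comment> \<open>The partial sum involves several \<open>X j\<close> at once, so its independence
    from \<open>Y t\<close> rests on measurability for the sigma-algebra generated by all of
    them.\<close>
  have indX: "indep_set {(\<lambda>\<omega>. \<Sum>j=1..k. X j \<omega>) -` A \<inter> space M |A. A \<in> sets ?C}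
      {Y t -` B \<inter> space M |B. True}" for k
    using \<open>t > 0\<close>
    by (intro indep_processes_imp_indep_set_vimages[OF assms(12)] measurable_sum_nat_count_space
        measurable_sigma_vimages) auto
  have "random_variable ?C (\<lambda>\<omega>. N (real (Y t \<omega>)) \<omega>)"
    by (rule measurable_compose_countable) measurable
  moreover have "random_variable ?C (\<lambda>\<omega>. \<Sum>j=1..Y t \<omega>. X j \<omega>)"
    by (rule measurable_compose_countable[of "\<lambda>k \<omega>. \<Sum>j=1..k. X j \<omega>"]) measurable
  moreover have "distr M ?C (\<lambda>\<omega>. N (real (Y t \<omega>)) \<omega>) = distr M ?C (\<lambda>\<omega>. \<Sum>j=1..Y t \<omega>. X j \<omega>)"
    by (rule distr_random_index_cong[OF Y Nm Xm indN indX
          distr_poisson_process_eq_sum_iid_poisson[OF assms(9,11)]])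
  ultimately show "eq_in_distribution M (\<lambda>\<omega>. N (real (Y t \<omega>)) \<omega>)
      M (\<lambda>\<omega>. \<Sum>j=1..Y t \<omega>. X j \<omega>) ?C"
    unfolding eq_in_distribution_def by blast
qed

end
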